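(* Let $\mathcal{X}$ be an infinite-dimensional normed linear space over $\mathbb{C}$ and let $T$ be a bounded linear operator on $\mathcal{X}$. If $x\in\mathcal{X}$ is a supercyclic vector for $T$, then there is a strictly increasing sequence $(n_k)_{k\ge1}$ of positive integers such that $$\bigvee\{T^{n_k}x: k\ge1\}\neq\mathcal{X}.$$
   Context: A nonzero vector $x\in\mathcal{X}$ is a supercyclic vector for $T$ if the set $\{bT^nx: b\in\mathbb{C},\ n\in\mathbb{N}_0\}$ is dense in $\mathcal{X}$, where $\mathbb{N}_0$ is the set of non-negative integers and $T^0=I$ is the identity operator. For a subset $M\subseteq\mathcal{X}$, $\bigvee M=\overline{\operatorname{span}M}$ denotes the closed linear span of $M$ in $\mathcal{X}$. *)

theory Defs
  imports "HOL-Analysis.Analysis"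
begin

text \<open>
  The distribution has no class of complex normed spaces. This one extends
  \<^class>\<open>real_normed_vector\<close>, so that norm and topology are the library's; no
  completeness is assumed. The axiom \<open>scaleR_scaleC\<close> says that the real structure is
  the restriction of scalars of the complex one.
\<close>

class complex_normed_vector = real_normed_vector +
  fixes scaleC :: "complex \<Rightarrow> 'a \<Rightarrow> 'a" (infixr \<open>*\<^sub>C\<close> 75)
  assumes scaleC_add_right: "a *\<^sub>C (x + y) = a *\<^sub>C x + a *\<^sub>C y"
    and scaleC_add_left: "(a + b) *\<^sub>C x = a *\<^sub>C x + b *\<^sub>C x"
    and scaleC_scaleC: "a *\<^sub>C (b *\<^sub>C x) = (a * b) *\<^sub>C x"
    and scaleC_one: "1 *\<^sub>C x = x"
    and scaleR_scaleC: "r *\<^sub>R x = complex_of_real r *\<^sub>C x"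
    and norm_scaleC: "norm (a *\<^sub>C x) = cmod a * norm x"

instantiation complex :: complex_normed_vector
begin

definition scaleC_complex :: "complex \<Rightarrow> complex \<Rightarrow> complex"
  where "scaleC_complex a x = a * x"

instance
  by standard (simp_all add: scaleC_complex_def algebra_simps norm_mult scaleR_conv_of_real)

end

global_interpretation complex_vector:
    vector_space "scaleC :: complex \<Rightarrow> 'a \<Rightarrow> 'a::complex_normed_vector"
  defines cspan = complex_vector.span
  by standard (simp_all add: scaleC_add_right scaleC_add_left scaleC_scaleC scaleC_one)

definition closed_cspan :: "'a::complex_normed_vector set \<Rightarrow> 'a set"
  where "closed_cspan M = closure (cspan M)"

definition infinite_cdim :: "'a::complex_normed_vector itself \<Rightarrow> bool"
  where "infinite_cdim _ \<longleftrightarrow>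
    (\<nexists>B. finite_dimensional_vector_space (scaleC :: complex \<Rightarrow> 'a \<Rightarrow> 'a) B)"

definition bounded_clinear ::
    "('a::complex_normed_vector \<Rightarrow> 'b::complex_normed_vector) \<Rightarrow> bool"
  where "bounded_clinear T \<longleftrightarrow>
    Vector_Spaces.linear scaleC scaleC T \<and> (\<exists>K. \<forall>x. norm (T x) \<le> norm x * K)"

definition supercyclic_vector ::
    "('a::complex_normed_vector \<Rightarrow> 'a) \<Rightarrow> 'a \<Rightarrow> bool"
  where "supercyclic_vector T x \<longleftrightarrow>
    x \<noteq> 0 \<and> closure {b *\<^sub>C (T ^^ n) x | b n. True} = UNIV"

end

theory Submission
  imports Defs
begin

text \<open>
  A nonempty open set cannot be covered by the finitely many lines
  \<open>\<complex> T\<^sup>0 x, \<dots>, \<complex> T\<^sup>N x\<close>, because the span of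
  finitely many vectors is a closed proper subspace. So, when \<open>x\<close> is supercyclic, every
  nonempty open set contains a multiple of \<open>T\<^sup>n x\<close> for some \<open>n\<close> beyond any given bound.
  The same holds for any sequence of vectors whose lines have a dense union, and the result is
  proved in that form (\<open>infinite_subfamily_avoiding_vector\<close>).

  The indices are chosen one after another so that the span of the chosen orbit vectors stays
  at distance more than \<open>c = \<parallel>x\<parallel> / 2\<close> from \<open>x\<close>; then the closure of the union of these
  spans misses \<open>x\<close>. The empty choice has distance \<open>\<parallel>x\<parallel>\<close>. Suppose that the current span
  \<open>F\<close> has distance at least \<open>d > c\<close> from \<open>x\<close>. By a Hahn--Banach argument
  (\<open>exists_direction_preserving_distance\<close>), any vector \<open>w\<close> can be shifted by a multiple of
  \<open>x\<close> to a vector \<open>v\<close> such that \<open>F + \<complex> v\<close> still has distance at least \<open>d\<close>. If \<open>v\<close> has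
  positive distance from \<open>F\<close>, then all vectors \<open>v'\<close> in a small ball around \<open>v\<close> keep the
  distance of \<open>F + \<complex> v'\<close> from \<open>x\<close> above any prescribed \<open>d' < d\<close>
  (\<open>distance_stable_under_perturbation\<close>). That ball contains a nonzero multiple of some
  \<open>T\<^sup>n x\<close> with \<open>n\<close> large, and this \<open>n\<close> is the next index. As the losses \<open>d - d'\<close> can be as
  small as desired, the distance never falls to \<open>c\<close>.
\<close>

section \<open>Finitely generated subspaces are closed\<close>

text \<open>
  If \<open>y\<close> has positive distance \<open>\<delta>\<close> from \<open>cspan A\<close>, the \<open>y\<close>-coefficient is a functional of norm
  at most \<open>1 / \<delta>\<close> on the larger span, so coefficients of a convergent sequence converge, and
  hence so do the components in \<open>cspan A\<close>.
\<close>

lemma closed_cspan_insert: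
  fixes y :: "'a::complex_normed_vector"
  assumes "closed (cspan A)"
  shows "closed (cspan (insert y A))"
proof (cases "y \<in> cspan A")
  case True
  then show ?thesis
    using assms complex_vector.span_redundant by metis
next
  case False
  then obtain \<delta> where \<delta>: "\<delta> > 0" "\<And>f. f \<in> cspan A \<Longrightarrow> \<delta> \<le> norm (y - f)"
  proof -
    have "open (- cspan A)" using assms by auto
    with False obtain \<delta> where "\<delta> > 0" "ball y \<delta> \<subseteq> - cspan A"
      by (meson ComplI openE)
    then show ?thesis
      by (intro that[of \<delta>]) (auto simp: subset_iff dist_norm not_less[symmetric])
  qed
  have coeff: "cmod t * \<delta> \<le> norm (t *\<^sub>C y - f)" if f: "f \<in> cspan A" for t f
  proof (cases "t = 0")
    case False
    then have "t *\<^sub>C y - f = t *\<^sub>C (y - inverse t *\<^sub>C f)"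
      by (simp add: complex_vector.scale_right_diff_distrib)
    moreover have "\<delta> \<le> norm (y - inverse t *\<^sub>C f)"
      by (intro \<delta> complex_vector.span_scale f)
    ultimately show ?thesis by (simp add: norm_scaleC mult_left_mono)
  qed simp
  show ?thesis
    unfolding closed_sequential_limits
  proof (intro allI impI, elim conjE)
    fix z l assume z: "\<forall>n. z n \<in> cspan (insert y A)" and lim: "z \<longlonglongrightarrow> l"
    from z obtain t where t: "\<And>n. z n - t n *\<^sub>C y \<in> cspan A"
      unfolding complex_vector.span_insert by simp metis
    have "Cauchy t"
    proof (rule metric_CauchyI)
      fix e :: real assume "e > 0"
      then have "e * \<delta> > 0" using \<delta> by simp
      with lim obtain M where M: "\<And>m n. m \<ge> M \<Longrightarrow> n \<ge> M \<Longrightarrow> dist (z m) (z n) < e * \<delta>"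
        using LIMSEQ_imp_Cauchy[OF lim] metric_CauchyD by blast
      have "dist (t m) (t n) < e" if "m \<ge> M" "n \<ge> M" for m n
      proof -
        have "(z n - t n *\<^sub>C y) - (z m - t m *\<^sub>C y) \<in> cspan A"
          by (intro complex_vector.span_diff t)
        from coeff[OF this, of "t m - t n"]
        have "cmod (t m - t n) * \<delta> \<le> norm (z m - z n)"
          by (simp add: complex_vector.scale_left_diff_distrib)
        also have "\<dots> < e * \<delta>" using M[OF that] by (simp add: dist_norm)
        finally show ?thesis using \<delta> by (simp add: dist_norm)
      qed
      then show "\<exists>M. \<forall>m\<ge>M. \<forall>n\<ge>M. dist (t m) (t n) < e" by blast
    qed
    then obtain s where s: "t \<longlonglongrightarrow> s" using Cauchy_convergent convergentD by blast
    have "(\<lambda>n. t n *\<^sub>C y) \<longlonglongrightarrow> s *\<^sub>C y"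
    proof (rule Lim_null_comparison[THEN LIM_zero_cancel])
      show "\<forall>\<^sub>F n in sequentially. norm (t n *\<^sub>C y - s *\<^sub>C y) \<le> cmod (t n - s) * norm y"
        by (simp add: norm_scaleC flip: complex_vector.scale_left_diff_distrib)
      show "(\<lambda>n. cmod (t n - s) * norm y) \<longlonglongrightarrow> 0"
        using tendsto_mult_left_zero[OF tendsto_norm_zero[OF LIM_zero[OF s]]] .
    qed
    from tendsto_diff[OF lim this] have "l - s *\<^sub>C y \<in> cspan A"
      using assms t unfolding closed_sequential_limits
      by (elim allE[of _ "\<lambda>n. z n - t n *\<^sub>C y"]) blast
    then show "l \<in> cspan (insert y A)" unfolding complex_vector.span_insert by blast
  qed
qed

lemma closed_cspan_finite:
  fixes A :: "'a::complex_normed_vector set"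
  assumes "finite A"
  shows "closed (cspan A)"
  using assms by induction (auto intro: closed_cspan_insert simp: complex_vector.span_empty)

lemma cspan_finite_neq_UNIV:
  fixes A :: "'a::complex_normed_vector set"
  assumes "infinite_cdim TYPE('a)" "finite A"
  shows "cspan A \<noteq> UNIV"
proof
  assume A: "cspan A = UNIV"
  obtain B where B: "B \<subseteq> A" "complex_vector.independent B" "A \<subseteq> cspan B"
    using complex_vector.maximal_independent_subset[of A] by blast
  have "finite_dimensional_vector_space (scaleC :: complex \<Rightarrow> 'a \<Rightarrow> 'a) B"
  proof
    show "finite B" using B assms finite_subset by blast
    show "complex_vector.independent B" by fact
    have "cspan A \<subseteq> cspan B"
      using B complex_vector.subspace_span by (intro complex_vector.span_minimal)
    then have "cspan B = UNIV" using A by blast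
    then show "module.span scaleC B = (UNIV :: 'a set)" by (simp add: cspan_def)
  qed
  with assms show False unfolding infinite_cdim_def by blast
qed

section \<open>A two-dimensional Hahn--Banach argument\<close>

text \<open>
  By Hahn--Banach in the quotient by \<open>F\<close>, some functional vanishes on \<open>F\<close>, has norm at most 1,
  and takes at \<open>y\<close> a value of modulus at least \<open>d\<close>; the wanted direction is the \<open>v \<in> w + \<complex> y\<close>
  in its kernel. Only the values of the functional on the span of \<open>y\<close> and \<open>w\<close> matter, so it can
  be found in \<open>\<complex>\<^sup>2\<close> by separating the point \<open>(1, 0)\<close> from the convex set of those coefficient
  pairs \<open>(a, b)\<close> for which \<open>a y + b w\<close> has distance less than \<open>d\<close> from \<open>F\<close>. That set is
  invariant under rotation by unimodular scalars, which turns the real separating functional into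
  a bound on the modulus of a complex one.
\<close>

lemma exists_direction_preserving_distance:
  fixes y w :: "'a::complex_normed_vector"
  assumes F: "complex_vector.subspace F"
    and d: "d > 0" and dist: "\<And>f. f \<in> F \<Longrightarrow> d \<le> norm (y + f)"
  shows "\<exists>\<mu>. \<forall>f\<in>F. \<forall>t. d \<le> norm (y + t *\<^sub>C (w + \<mu> *\<^sub>C y) + f)"
proof -
  define S where
    "S = {s. \<exists>f\<in>F. norm (fst s *\<^sub>C y + snd s *\<^sub>C w + f) < d}"
  have scale: "(\<zeta> * a, \<zeta> * b) \<in> S"
    if "f \<in> F" "cmod \<zeta> * norm (a *\<^sub>C y + b *\<^sub>C w + f) < d" for \<zeta> a b f
  proof -
    have "(\<zeta> * a) *\<^sub>C y + (\<zeta> * b) *\<^sub>C w + \<zeta> *\<^sub>C f = \<zeta> *\<^sub>C (a *\<^sub>C y + b *\<^sub>C w + f)"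
      by (simp add: scaleC_add_right scaleC_scaleC)
    moreover have "\<zeta> *\<^sub>C f \<in> F" using F that(1) by (simp add: complex_vector.subspace_scale)
    ultimately show ?thesis using that(2) unfolding S_def
      by (auto simp: norm_scaleC intro!: bexI[of _ "\<zeta> *\<^sub>C f"])
  qed
  have "convex S"
  proof (rule convexI)
    fix p q :: "complex \<times> complex" and u v :: real
    assume pq: "p \<in> S" "q \<in> S" and uv: "0 \<le> u" "0 \<le> v" "u + v = 1"
    from pq obtain f g where fg: "f \<in> F" "g \<in> F"
      "norm (fst p *\<^sub>C y + snd p *\<^sub>C w + f) < d" "norm (fst q *\<^sub>C y + snd q *\<^sub>C w + g) < d"
      unfolding S_def by blast
    let ?h = "u *\<^sub>R f + v *\<^sub>R g"
    have "?h \<in> F"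
      using F fg by (simp add: scaleR_scaleC complex_vector.subspace_add complex_vector.subspace_scale)
    moreover have "u *\<^sub>R (fst p *\<^sub>C y + snd p *\<^sub>C w + f) + v *\<^sub>R (fst q *\<^sub>C y + snd q *\<^sub>C w + g) \<in> ball 0 d"
      using fg uv by (intro convexD[OF convex_ball]) auto
    moreover have "u *\<^sub>R (fst p *\<^sub>C y + snd p *\<^sub>C w + f) + v *\<^sub>R (fst q *\<^sub>C y + snd q *\<^sub>C w + g)
      = fst (u *\<^sub>R p + v *\<^sub>R q) *\<^sub>C y + snd (u *\<^sub>R p + v *\<^sub>R q) *\<^sub>C w + ?h"
      by (simp add: scaleR_scaleC scaleC_add_right scaleC_add_left scaleC_scaleC scaleC_complex_def
          scaleR_conv_of_real algebra_simps)
    ultimately show "u *\<^sub>R p + v *\<^sub>R q \<in> S"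
      unfolding S_def by (auto intro!: bexI[of _ ?h])
  qed
  have S0: "(0, 0) \<in> S"
    using d complex_vector.subspace_0[OF F] by (auto simp: S_def intro!: bexI[of _ 0])
  have "(1, 0) \<notin> S"
    using dist by (force simp: S_def scaleC_one not_less)
  then have "\<exists>c \<beta>. c \<noteq> 0 \<and> (\<forall>s\<in>S. inner c s \<le> \<beta>) \<and> (\<forall>s\<in>{(1, 0)}. inner c s \<ge> \<beta>)"
    using \<open>convex S\<close> S0 by (intro separating_hyperplane_sets) auto
  then obtain c \<beta> where c: "c \<noteq> 0" and le: "\<And>s. s \<in> S \<Longrightarrow> inner c s \<le> \<beta>" and ge: "inner c (1, 0) \<ge> \<beta>"
    by (elim exE conjE) (rule that; simp)
  \<comment> \<open>The complex-linear functional whose real part is the separating functional \<open>inner c\<close>.\<close>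
  define h where "h a b = cnj (fst c) * a + cnj (snd c) * b" for a b
  have inner: "inner c (a, b) = Re (h a b)" for a b
    by (cases c) (simp add: h_def inner_complex_def)
  have h_le: "cmod (h a b) \<le> Re (fst c)" if "(a, b) \<in> S" for a b
  proof (cases "h a b = 0")
    case True
    then show ?thesis using le[OF S0] ge unfolding inner by (simp add: h_def)
  next
    case False
    define \<zeta> where "\<zeta> = cnj (h a b) / cmod (h a b)"
    have "cmod \<zeta> = 1" using False by (simp add: \<zeta>_def norm_divide)
    then have "(\<zeta> * a, \<zeta> * b) \<in> S" using that scale by (auto simp: S_def)
    from le[OF this] ge have "Re (h (\<zeta> * a) (\<zeta> * b)) \<le> Re (fst c)"
      unfolding inner by (simp add: h_def)
    moreover have "h (\<zeta> * a) (\<zeta> * b) = cmod (h a b)"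
    proof -
      have "h (\<zeta> * a) (\<zeta> * b) = \<zeta> * h a b" by (simp add: h_def algebra_simps)
      also have "\<dots> = (h a b * cnj (h a b)) / cmod (h a b)" by (simp add: \<zeta>_def)
      also have "\<dots> = cmod (h a b)"
        using False by (simp add: complex_norm_square[symmetric] power2_eq_square)
      finally show ?thesis .
    qed
    ultimately show ?thesis by simp
  qed
  \<comment> \<open>Otherwise \<open>h\<close> would vanish on \<open>S\<close>, which contains \<open>(0, r)\<close> for small \<open>r > 0\<close>.\<close>
  have "fst c \<noteq> 0"
  proof
    assume c0: "fst c = 0"
    then have c1: "snd c \<noteq> 0" using c by (simp add: prod_eq_iff)
    define r where "r = d / (2 * (norm w + 1))"
    have r: "r > 0" using d by (simp add: r_def add_nonneg_pos)
    have "r * norm w \<le> r * (norm w + 1)" using r by simp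
    also have "\<dots> < d"
    proof -
      have "norm w + 1 > 0" by (simp add: add_nonneg_pos)
      then show ?thesis using d by (simp add: r_def divide_simps)
    qed
    finally have "(complex_of_real r * 0, complex_of_real r * 1) \<in> S"
      using r complex_vector.subspace_0[OF F] by (intro scale[of 0]) (auto simp: scaleC_one)
    from h_le[OF this] c0 c1 r show False by (simp add: h_def)
  qed
  \<comment> \<open>The root of \<open>h \<mu> 1 = 0\<close>, so that adding \<open>t (\<mu>, 1)\<close> to \<open>(1, 0)\<close> does not change \<open>h\<close>.\<close>
  define \<mu> where "\<mu> = - cnj (snd c) / cnj (fst c)"
  have "d \<le> norm (y + t *\<^sub>C (w + \<mu> *\<^sub>C y) + f)" if f: "f \<in> F" for f t
  proof (rule ccontr)
    let ?N = "norm (y + t *\<^sub>C (w + \<mu> *\<^sub>C y) + f)"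
    assume "\<not> d \<le> ?N"
    then have N: "?N < d" by simp
    \<comment> \<open>The bound \<open>h_le\<close> is not strict, so a contradiction needs a point of \<open>S\<close> slightly beyond
      \<open>(1 + t \<mu>, t)\<close>.\<close>
    obtain \<rho> :: real where \<rho>: "\<rho> > 1" "\<rho> * ?N < d"
    proof (cases "?N = 0")
      case True then show ?thesis using d by (intro that[of 2]) auto
    next
      case False
      then have pos: "?N > 0" by simp
      with N have "1 < d / ?N" by simp
      then obtain \<rho> where "1 < \<rho>" "\<rho> < d / ?N" using dense by blast
      then show ?thesis using pos by (intro that[of \<rho>]) (auto simp: pos_less_divide_eq)
    qed
    have eq: "y + t *\<^sub>C (w + \<mu> *\<^sub>C y) + f = (1 + t * \<mu>) *\<^sub>C y + t *\<^sub>C w + f"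
      by (simp add: scaleC_add_right scaleC_add_left scaleC_scaleC scaleC_one)
    have "(of_real \<rho> * (1 + t * \<mu>), of_real \<rho> * t) \<in> S"
      using f \<rho> by (intro scale[of f]) (auto simp: eq)
    moreover have "h (of_real \<rho> * (1 + t * \<mu>)) (of_real \<rho> * t) = of_real \<rho> * cnj (fst c)"
      using \<open>fst c \<noteq> 0\<close> by (simp add: h_def \<mu>_def field_simps)
    ultimately have "\<rho> * cmod (fst c) \<le> Re (fst c)" using h_le \<rho> by (fastforce simp: norm_mult)
    also have "\<dots> \<le> cmod (fst c)" by (rule complex_Re_le_cmod)
    finally show False using \<rho> \<open>fst c \<noteq> 0\<close> by simp
  qed
  then show ?thesis by blast
qed

section \<open>Perturbing the new direction\<close>

text \<open>
  Moving \<open>v\<close> by \<open>\<epsilon>\<close> moves \<open>y + t v + f\<close> by up to \<open>|t| \<epsilon>\<close>, which is harmless for bounded \<open>t\<close>.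
  For large \<open>t\<close> the norm is large anyway: \<open>t v + f\<close> has norm at least \<open>|t| \<delta>\<close>, and \<open>y\<close> and a
  perturbation by at most \<open>|t| \<delta> / 2\<close> do not cancel it.
\<close>

lemma distance_stable_under_perturbation:
  fixes y v :: "'a::complex_normed_vector"
  assumes F: "complex_vector.subspace F"
    and d: "\<And>f t. f \<in> F \<Longrightarrow> d \<le> norm (y + t *\<^sub>C v + f)"
    and \<delta>: "\<delta> > 0" "\<And>f. f \<in> F \<Longrightarrow> \<delta> \<le> norm (v + f)"
    and "0 \<le> d'" "d' < d"
  shows "\<exists>\<epsilon>>0. \<forall>v'. norm (v' - v) \<le> \<epsilon> \<longrightarrow> (\<forall>f\<in>F. \<forall>t. d' \<le> norm (y + t *\<^sub>C v' + f))"
proof -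
  \<comment> \<open>The threshold between the two ranges of \<open>t\<close>: from \<open>R\<close> on, \<open>|t| \<delta> / 2\<close> exceeds
    \<open>d' + \<parallel>y\<parallel>\<close>. The summand 1 makes \<open>R\<close> positive.\<close>
  define R where "R = 2 * (d' + norm y + 1) / \<delta>"
  have R: "R > 0" using assms by (simp add: R_def add_nonneg_pos)
  define \<epsilon> where "\<epsilon> = min (\<delta> / 2) ((d - d') / R)"
  have "\<epsilon> > 0" using R assms by (simp add: \<epsilon>_def)
  moreover have "d' \<le> norm (y + t *\<^sub>C v' + f)" if v': "norm (v' - v) \<le> \<epsilon>" and f: "f \<in> F" for v' f t
  proof -
    have "y + t *\<^sub>C v + f = (y + t *\<^sub>C v' + f) - t *\<^sub>C (v' - v)"
      by (simp add: complex_vector.scale_right_diff_distrib)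
    then have "norm (y + t *\<^sub>C v + f) \<le> norm (y + t *\<^sub>C v' + f) + norm (t *\<^sub>C (v' - v))"
      by (metis norm_triangle_ineq4)
    moreover have "norm (t *\<^sub>C (v' - v)) \<le> cmod t * \<epsilon>"
      using v' by (simp add: norm_scaleC mult_left_mono)
    ultimately have close: "norm (y + t *\<^sub>C v + f) - cmod t * \<epsilon> \<le> norm (y + t *\<^sub>C v' + f)"
      by linarith
    show ?thesis
    proof (cases "cmod t \<le> R")
      case True
      have "cmod t * \<epsilon> \<le> R * ((d - d') / R)"
        using True R \<open>\<epsilon> > 0\<close> by (intro mult_mono) (auto simp: \<epsilon>_def)
      then have "cmod t * \<epsilon> \<le> d - d'" using R by simp
      with close d[OF f, of t] show ?thesis by linarith
    next
      case False
      with R have "t \<noteq> 0" by auto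
      then have eq: "t *\<^sub>C v + f = t *\<^sub>C (v + inverse t *\<^sub>C f)"
        by (simp add: scaleC_add_right scaleC_scaleC scaleC_one)
      have "\<delta> \<le> norm (v + inverse t *\<^sub>C f)"
        by (intro \<delta> complex_vector.subspace_scale F f)
      then have "cmod t * \<delta> \<le> norm (t *\<^sub>C v + f)"
        unfolding eq norm_scaleC by (simp add: mult_left_mono)
      moreover have "norm (t *\<^sub>C v + f) \<le> norm (y + t *\<^sub>C v + f) + norm y"
        using norm_triangle_ineq4[of "y + t *\<^sub>C v + f" y] by (simp add: algebra_simps)
      moreover have "cmod t * \<epsilon> \<le> cmod t * (\<delta> / 2)" unfolding \<epsilon>_def by (intro mult_left_mono min.cobounded1) simp
      moreover have "R * (\<delta> / 2) \<le> cmod t * (\<delta> / 2)" using False \<delta> by (intro mult_right_mono) auto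
      moreover have "R * (\<delta> / 2) = d' + norm y + 1" using \<delta> by (simp add: R_def)
      ultimately show ?thesis using close by linarith
    qed
  qed
  ultimately show ?thesis by blast
qed

section \<open>Subsequences of a sequence whose lines are dense\<close>

text \<open>
  The unperturbed direction is taken outside \<open>G\<close>, the span of \<open>y\<close>, of the current vectors and of
  \<open>g 0, \<dots>, g N\<close>. As \<open>G\<close> is closed, a whole ball around that direction avoids \<open>G\<close>; this gives
  the positive distance needed for the perturbation and forces the index found in the ball to
  exceed \<open>N\<close>.
\<close>

lemma extend_index_set:
  fixes g :: "nat \<Rightarrow> 'a::complex_normed_vector"
  assumes inf: "infinite_cdim TYPE('a)"
    and dense: "closure {b *\<^sub>C g n | b n. True} = UNIV"
    and "finite S"
    and d: "0 \<le> d'" "d' < d" "\<And>f. f \<in> cspan (g ` S) \<Longrightarrow> d \<le> norm (y + f)"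
  shows "\<exists>m. m > N \<and> (\<forall>f \<in> cspan (g ` insert m S). d' \<le> norm (y + f))"
proof -
  define G where "G = cspan (insert y (g ` ({..N} \<union> S)))"
  let ?F = "cspan (g ` S)"
  have G: "complex_vector.subspace G" "y \<in> G" "?F \<subseteq> G" "closed G" "\<And>n. n \<le> N \<Longrightarrow> g n \<in> G"
    unfolding G_def using \<open>finite S\<close>
    by (auto intro!: complex_vector.span_base complex_vector.span_mono closed_cspan_finite)
  obtain w where w: "w \<notin> G"
    unfolding G_def using cspan_finite_neq_UNIV[OF inf] \<open>finite S\<close>
    by (metis UNIV_eq_I finite_Un finite_atMost finite_imageI finite_insert)
  obtain \<mu> where \<mu>: "\<And>f t. f \<in> ?F \<Longrightarrow> d \<le> norm (y + t *\<^sub>C (w + \<mu> *\<^sub>C y) + f)"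
    using exists_direction_preserving_distance[of ?F d y w] d by force
  define v where "v = w + \<mu> *\<^sub>C y"
  have "v \<notin> G"
  proof
    assume "v \<in> G"
    then have "v - \<mu> *\<^sub>C y \<in> G"
      by (intro complex_vector.subspace_diff complex_vector.subspace_scale G)
    with w show False by (simp add: v_def)
  qed
  moreover have "open (- G)" using G by auto
  ultimately obtain \<delta> where \<delta>: "\<delta> > 0" and ball: "ball v \<delta> \<subseteq> - G"
    by (meson ComplI openE)
  have "\<delta> \<le> norm (v + f)" if "f \<in> ?F" for f
  proof (rule ccontr)
    assume "\<not> \<delta> \<le> norm (v + f)"
    then have "- f \<in> ball v \<delta>" by (simp add: dist_norm)
    moreover have "- f \<in> G" using that G complex_vector.subspace_neg by blast
    ultimately show False using ball by blast
  qed
  with \<delta> \<mu> d obtain \<epsilon> where \<epsilon>: "\<epsilon> > 0"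
    "\<And>v' f t. norm (v' - v) \<le> \<epsilon> \<Longrightarrow> f \<in> ?F \<Longrightarrow> d' \<le> norm (y + t *\<^sub>C v' + f)"
    using distance_stable_under_perturbation[of ?F d y v \<delta> d'] unfolding v_def by auto
  obtain b m where bm: "dist (b *\<^sub>C g m) v < min \<delta> \<epsilon>"
    using dense \<delta> \<epsilon>(1) closure_approachable[of v "{b *\<^sub>C g n | b n. True}"]
    by (smt (verit) UNIV_I mem_Collect_eq min_less_iff_conj)
  then have "b *\<^sub>C g m \<notin> G" using ball by (auto simp: subset_iff dist_commute)
  then have "m > N"
    using G(5) complex_vector.subspace_scale[OF G(1)] by (meson not_le)
  have "b \<noteq> 0"
    using \<open>b *\<^sub>C g m \<notin> G\<close> complex_vector.subspace_0[OF G(1)] by auto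
  have "d' \<le> norm (y + f)" if "f \<in> cspan (g ` insert m S)" for f
  proof -
    from that have "\<exists>t. f - t *\<^sub>C g m \<in> ?F"
      unfolding image_insert complex_vector.span_insert by simp
    then obtain t where t: "f - t *\<^sub>C g m \<in> ?F" ..
    have eq: "y + (t / b) *\<^sub>C (b *\<^sub>C g m) + (f - t *\<^sub>C g m) = y + f"
      using \<open>b \<noteq> 0\<close> by (simp add: scaleC_scaleC)
    have "norm (b *\<^sub>C g m - v) \<le> \<epsilon>" using bm by (simp add: dist_norm)
    from \<epsilon>(2)[OF this t, of "t / b"] show ?thesis unfolding eq .
  qed
  with \<open>m > N\<close> show ?thesis by blast
qed

text \<open>
  Each step of the iteration lowers the distance from \<open>d\<close> to the midpoint of \<open>c\<close> and \<open>d\<close>, which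
  is still greater than \<open>c\<close>, so the process never stops. In the
  limit a vector of the span of the union lies in one of the finite stages, so its distance from
  \<open>y\<close> exceeds \<open>c\<close>.
\<close>

lemma infinite_subfamily_avoiding_vector:
  fixes g :: "nat \<Rightarrow> 'a::complex_normed_vector"
  assumes inf: "infinite_cdim TYPE('a)"
    and dense: "closure {b *\<^sub>C g n | b n. True} = UNIV"
    and "y \<noteq> 0"
  shows "\<exists>U. infinite U \<and> 0 \<notin> U \<and> y \<notin> closed_cspan (g ` U)"
proof -
  define c where "c = norm y / 2"
  have c: "c > 0" "c < norm y" using \<open>y \<noteq> 0\<close> by (auto simp: c_def)
  define P where "P S \<longleftrightarrow> finite S \<and> 0 \<notin> S \<and> (\<exists>d>c. \<forall>f\<in>cspan (g ` S). d \<le> norm (y + f))" for S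
  have "\<exists>S. \<forall>n. P (S n) \<and> S n \<subset> S (Suc n)"
  proof (rule dependent_nat_choice)
    show "\<exists>S. P S" using c by (intro exI[of _ "{}"]) (auto simp: P_def complex_vector.span_empty)
  next
    fix S n assume "P S"
    then obtain d where S: "finite S" "0 \<notin> S" "d > c" "\<And>f. f \<in> cspan (g ` S) \<Longrightarrow> d \<le> norm (y + f)"
      unfolding P_def by blast
    have "0 \<le> (c + d) / 2" "(c + d) / 2 < d" using S(3) c by auto
    from extend_index_set[OF inf dense S(1) this S(4)]
    obtain m where m: "m > Max (insert 0 S)" "\<forall>f \<in> cspan (g ` insert m S). (c + d) / 2 \<le> norm (y + f)"
      by blast
    have "m \<notin> insert 0 S" using m(1) S(1) Max_ge[of "insert 0 S" m] by auto
    then have "S \<subset> insert m S" "finite (insert m S)" "0 \<notin> insert m S" using S by auto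
    moreover have "(c + d) / 2 > c" using S(3) by simp
    ultimately have "S \<subset> insert m S" "P (insert m S)"
      using m(2) unfolding P_def by blast+
    then show "\<exists>S'. P S' \<and> S \<subset> S'" by blast
  qed
  then obtain S where S: "\<forall>n. P (S n) \<and> S n \<subset> S (Suc n)" by (rule exE)
  then have P: "P (S n)" and less: "S n \<subset> S (Suc n)" for n by simp_all
  have mono: "S m \<subseteq> S n" if "m \<le> n" for m n
    by (rule lift_Suc_mono_le[of S, OF psubset_imp_subset[OF less] that])
  define U where "U = (\<Union>n. S n)"
  have "infinite U"
  proof
    assume "finite U"
    moreover have "card (S n) \<ge> n" for n
    proof (induction n)
      case (Suc n)
      have "card (S n) < card (S (Suc n))"
        using less P by (intro psubset_card_mono) (auto simp: P_def)
      with Suc show ?case by simp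
    qed simp
    moreover have "card (S n) \<le> card U" for n
      using \<open>finite U\<close> by (intro card_mono) (auto simp: U_def)
    ultimately show False by (metis not_less_eq_eq order_trans)
  qed
  moreover have "0 \<notin> U" using P by (auto simp: U_def P_def)
  moreover have "y \<notin> closed_cspan (g ` U)"
  proof
    assume "y \<in> closed_cspan (g ` U)"
    then obtain f where f: "f \<in> cspan (g ` U)" "dist f y < c"
      unfolding closed_cspan_def closure_approachable using c by blast
    have "\<exists>n. f \<in> cspan (g ` S n)"
      using f(1)
    proof (induction rule: complex_vector.span_induct_alt)
      case base
      then show ?case by (simp add: complex_vector.span_zero)
    next
      case (step a p q)
      then obtain i n where i: "p = g i" "i \<in> S n" unfolding U_def by blast
      from step obtain n' where n': "q \<in> cspan (g ` S n')" by blast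
      let ?k = "max n n'"
      have "p \<in> cspan (g ` S ?k)"
        using i mono[of n ?k] by (auto intro: complex_vector.span_base)
      moreover have "q \<in> cspan (g ` S ?k)"
        using n' mono[of n' ?k] complex_vector.span_mono[OF image_mono] by (meson max.cobounded2 subsetD)
      ultimately show ?case
        by (blast intro: complex_vector.span_add complex_vector.span_scale)
    qed
    then obtain n where "- f \<in> cspan (g ` S n)" using complex_vector.span_neg by blast
    then have "c < norm (y + - f)" using P[of n] unfolding P_def by force
    with f(2) show False by (simp add: dist_norm norm_minus_commute)
  qed
  ultimately show ?thesis by blast
qed

theorem theorem4p4:
  fixes T :: "'a::complex_normed_vector \<Rightarrow> 'a" and x :: 'a
  assumes "infinite_cdim TYPE('a)"
    and "bounded_clinear T"
    and "supercyclic_vector T x"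
  shows "\<exists>n :: nat \<Rightarrow> nat. strict_mono_on {1..} n \<and> (\<forall>k\<ge>1. n k > 0) \<and>
    closed_cspan {(T ^^ n k) x | k. k \<ge> 1} \<noteq> UNIV"
proof -
  have "closure {b *\<^sub>C (T ^^ n) x | b n. True} = UNIV" "x \<noteq> 0"
    using assms(3) by (auto simp: supercyclic_vector_def)
  then obtain U where U: "infinite U" "0 \<notin> U" "x \<notin> closed_cspan ((\<lambda>n. (T ^^ n) x) ` U)"
    using infinite_subfamily_avoiding_vector[OF assms(1), of "\<lambda>n. (T ^^ n) x" x] by blast
  have mem: "enumerate U k \<in> U" for k using enumerate_in_set[OF U(1)] .
  have "strict_mono_on {1..} (enumerate U)"
    using strict_mono_enumerate[OF U(1)] by (auto simp: strict_mono_def strict_mono_on_def)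
  moreover have "enumerate U k > 0" for k using mem[of k] U(2) by (metis gr0I)
  moreover have "{(T ^^ enumerate U k) x | k. k \<ge> 1} \<subseteq> (\<lambda>n. (T ^^ n) x) ` U"
    using mem by blast
  then have "closed_cspan {(T ^^ enumerate U k) x | k. k \<ge> 1} \<subseteq> closed_cspan ((\<lambda>n. (T ^^ n) x) ` U)"
    unfolding closed_cspan_def by (intro closure_mono complex_vector.span_mono)
  then have "closed_cspan {(T ^^ enumerate U k) x | k. k \<ge> 1} \<noteq> UNIV" using U(3) by blast
  ultimately show ?thesis by blast
qed

end
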